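(* Let $S_1$ be an $r_1$-regular signed graph on $n_1$ vertices with Laplacian eigenvalues (with multiplicity) $\lambda_1(S_1),\dots,\lambda_{n_1}(S_1)$, and let $S_2$ be an $r_2$-regular and $r_3$-net regular signed graph on $n_2$ vertices with Laplacian eigenvalues (with multiplicity) $\lambda_1(S_2),\dots,\lambda_{n_2}(S_2)$, where $\lambda_k(S_2)=r_2-r_3$ for a fixed index $k$, $1\le k\le n_2$. Then the Laplacian spectrum (as a multiset) of $S_1\star_s S_2$ consists of: (i) the eigenvalue $\lambda_j(S_2)+r_1$ with multiplicity $n_1$, for every $j\in\{1,\dots,n_2\}$ with $j\neq k$; (ii) the two eigenvalues $$\frac{\beta\pm\sqrt{\beta^2+4\left(n_2(\lambda_i(S_1)-r_1)^2-(\lambda_i(S_1)+r_1n_2)(r_1+r_2-r_3)\right)}}{2},$$ where $\beta=r_1+r_2-r_3+\lambda_i(S_1)+r_1n_2$, for each $i=1,\dots,n_1$.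
   Context: A signed graph $S=(G,\sigma)$ is a finite simple graph $G$ with a sign function $\sigma:E_G\to\{-1,1\}$. Its adjacency matrix $A_S$ has $(i,j)$ entry $\sigma(v_iv_j)$ if $v_i\sim v_j$ and $0$ otherwise. $D_S$ is the diagonal matrix of vertex degrees (degrees in $G$), and the Laplacian matrix is $L_S=D_S-A_S$; Laplacian eigenvalues/spectrum are those of $L_S$. $S$ is $r$-regular if $G$ is $r$-regular. The net-degree of a vertex is the number of positive edges minus the number of negative edges incident with it; $S$ is $r$-net regular if every vertex has net-degree $r$. The s-neighbourhood corona $S_1\star_s S_2$ of signed graphs $S_1=(G_1,\sigma_1)$ (vertices $v_1,\dots,v_{n_1}$) and $S_2$ (with $n_2$ vertices) is the signed graph on $n_1(n_2+1)$ vertices obtained by taking one copy of $S_1$ and $n_1$ disjoint copies of $S_2$, and, for each $i$ and each neighbour $v_h$ of $v_i$ in $S_1$, joining $v_h$ to every vertex of the $i$th copy of $S_2$ by an edge of sign $\sigma_1(v_hv_i)$. *)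

theory Defs
  imports "Jordan_Normal_Form.Char_Poly"
begin

record 'a sgraph =
  sverts :: "'a set"
  sedges :: "'a set set"
  ssign :: "'a set \<Rightarrow> int"

text \<open>Edges are two-element sets of vertices, so the underlying graph is simple.
  The value of \<open>ssign\<close> outside \<open>sedges\<close> is irrelevant.\<close>

definition signed_graph :: "'a sgraph \<Rightarrow> bool" where
  "signed_graph S \<longleftrightarrow>
     finite (sverts S) \<and>
     (\<forall>e\<in>sedges S. e \<subseteq> sverts S \<and> card e = 2) \<and>
     (\<forall>e\<in>sedges S. ssign S e \<in> {-1, 1})"

definition vdegree :: "'a sgraph \<Rightarrow> 'a \<Rightarrow> nat" where
  "vdegree S v = card {e \<in> sedges S. v \<in> e}"

definition net_degree :: "'a sgraph \<Rightarrow> 'a \<Rightarrow> int" where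
  "net_degree S v =
     int (card {e \<in> sedges S. v \<in> e \<and> ssign S e = 1})
     - int (card {e \<in> sedges S. v \<in> e \<and> ssign S e = -1})"

definition regular_sg :: "nat \<Rightarrow> 'a sgraph \<Rightarrow> bool" where
  "regular_sg r S \<longleftrightarrow> (\<forall>v\<in>sverts S. vdegree S v = r)"

definition net_regular_sg :: "int \<Rightarrow> 'a sgraph \<Rightarrow> bool" where
  "net_regular_sg r S \<longleftrightarrow> (\<forall>v\<in>sverts S. net_degree S v = r)"

text \<open>The matrices below are taken with respect to a listing \<open>vs\<close> of the vertices.\<close>

definition adjacency_mat :: "'a sgraph \<Rightarrow> 'a list \<Rightarrow> real mat" where
  "adjacency_mat S vs = mat (length vs) (length vs)
     (\<lambda>(i, j). if {vs ! i, vs ! j} \<in> sedges S then of_int (ssign S {vs ! i, vs ! j}) else 0)"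

definition degree_mat :: "'a sgraph \<Rightarrow> 'a list \<Rightarrow> real mat" where
  "degree_mat S vs = mat (length vs) (length vs)
     (\<lambda>(i, j). if i = j then of_nat (vdegree S (vs ! i)) else 0)"

definition laplacian_mat :: "'a sgraph \<Rightarrow> 'a list \<Rightarrow> real mat" where
  "laplacian_mat S vs = degree_mat S vs - adjacency_mat S vs"

definition vertex_listing :: "'a sgraph \<Rightarrow> 'a list \<Rightarrow> bool" where
  "vertex_listing S vs \<longleftrightarrow> distinct vs \<and> set vs = sverts S"

text \<open>The multiset of roots of the characteristic polynomial, that is, the eigenvalues counted
  with algebraic multiplicity. The Laplacian matrix is real and symmetric, so no eigenvalue is
  lost by taking roots in the reals. The choice of the vertex listing is immaterial, see
  \<open>laplacian_spectrum_eq\<close> below.\<close>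

definition laplacian_spectrum :: "'a sgraph \<Rightarrow> real multiset" where
  "laplacian_spectrum S = proots (char_poly (laplacian_mat S (SOME vs. vertex_listing S vs)))"

lemma char_poly_permute:
  fixes f :: "'a \<Rightarrow> 'a \<Rightarrow> 'b :: comm_ring_1"
  assumes "distinct xs" "distinct ys" "set xs = set ys"
  shows "char_poly (mat (length xs) (length xs) (\<lambda>(i, j). f (xs ! i) (xs ! j))) =
         char_poly (mat (length ys) (length ys) (\<lambda>(i, j). f (ys ! i) (ys ! j)))"
proof -
  define n where "n = length ys"
  have ms: "mset xs = mset ys"
    using assms by (simp add: set_eq_iff_mset_eq_distinct)
  have len: "length xs = n"
    using ms unfolding n_def by (metis size_mset)
  obtain p where p: "p permutes {..<n}" and xs: "permute_list p ys = xs"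
    using mset_eq_permutation[OF ms] unfolding n_def by blast
  have p': "p permutes {0..<n}"
    using p by (simp add: atLeast0LessThan)
  have nth: "xs ! i = ys ! p i" if "i < n" for i
    using that p xs permute_list_nth[of p ys i] unfolding n_def by auto
  have plt: "p i < n" if "i < n" for i
    using that p permutes_in_image[OF p, of i] by simp
  have pinj: "p i = p j \<longleftrightarrow> i = j" for i j
    using permutes_inj[OF p] by (auto dest: injD)
  define B where "B = char_poly_matrix (mat n n (\<lambda>(i, j). f (ys ! i) (ys ! j)))"
  define C where "C = mat n n (\<lambda>(i, j). B $$ (p i, j))"
  have B: "B \<in> carrier_mat n n" unfolding B_def by simp
  have C: "C \<in> carrier_mat n n" unfolding C_def by simp
  have eq: "char_poly_matrix (mat n n (\<lambda>(i, j). f (xs ! i) (xs ! j)))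
      = transpose_mat (mat n n (\<lambda>(i, j). transpose_mat C $$ (p i, j)))"
    by (rule eq_matI) (auto simp: C_def B_def char_poly_matrix_def nth plt pinj)
  have dC: "det C = signof p * det B"
    unfolding C_def by (rule det_permute_rows[OF B p'])
  have "det (transpose_mat (mat n n (\<lambda>(i, j). transpose_mat C $$ (p i, j)))) =
        det (mat n n (\<lambda>(i, j). transpose_mat C $$ (p i, j)))"
    by (rule det_transpose[of _ n]) simp
  also have "\<dots> = signof p * det (transpose_mat C)"
    by (rule det_permute_rows[OF _ p']) (use C in simp)
  also have "\<dots> = signof p * (signof p * det B)"
    using det_transpose[OF C] dC by simp
  also have "\<dots> = det B"
    by (simp add: sign_def)
  finally have "det (char_poly_matrix (mat n n (\<lambda>(i, j). f (xs ! i) (xs ! j)))) = det B"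
    unfolding eq .
  then show ?thesis
    unfolding char_poly_def B_def len n_def .
qed

lemma laplacian_spectrum_eq:
  assumes "vertex_listing S vs"
  shows "laplacian_spectrum S = proots (char_poly (laplacian_mat S vs))"
proof -
  define ws where "ws = (SOME vs. vertex_listing S vs)"
  have ws: "vertex_listing S ws"
    unfolding ws_def using assms by (rule someI)
  define f where "f u v = (if u = v then of_nat (vdegree S u) else 0)
      - (if {u, v} \<in> sedges S then of_int (ssign S {u, v}) else (0::real))" for u v
  have *: "laplacian_mat S us = mat (length us) (length us) (\<lambda>(i, j). f (us ! i) (us ! j))"
    if "distinct us" for us
    using that by (intro eq_matI)
      (auto simp: laplacian_mat_def degree_mat_def adjacency_mat_def f_def nth_eq_iff_index_eq)
  show ?thesis
    unfolding laplacian_spectrum_def ws_def[symmetric]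
    using char_poly_permute[of ws vs f] assms ws * by (simp add: vertex_listing_def)
qed

text \<open>In the corona, \<open>Inl v\<close> is the vertex \<open>v\<close> of the copy of \<open>S\<^sub>1\<close>, and \<open>Inr (v, x)\<close> is the vertex
  \<open>x\<close> of the copy of \<open>S\<^sub>2\<close> belonging to \<open>v\<close>. An edge contained in \<open>range Inr\<close> lies in a copy of \<open>S\<^sub>2\<close>;
  any other edge \<open>{Inl u, Inl v}\<close> or \<open>{Inl u, Inr (v, x)}\<close> carries the sign of \<open>{u, v}\<close>.\<close>

definition s_nbhd_corona :: "'a sgraph \<Rightarrow> 'b sgraph \<Rightarrow> ('a + 'a \<times> 'b) sgraph" where
  "s_nbhd_corona S1 S2 = \<lparr>
     sverts = Inl ` sverts S1 \<union> Inr ` (sverts S1 \<times> sverts S2),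
     sedges = {{Inl u, Inl v} | u v. {u, v} \<in> sedges S1}
       \<union> {{Inr (v, x), Inr (v, y)} | v x y. v \<in> sverts S1 \<and> {x, y} \<in> sedges S2}
       \<union> {{Inl u, Inr (v, x)} | u v x. {u, v} \<in> sedges S1 \<and> x \<in> sverts S2},
     ssign = (\<lambda>e. if e \<subseteq> range Inr then ssign S2 ((\<lambda>w. snd (projr w)) ` e)
                  else ssign S1 (case_sum id fst ` e)) \<rparr>"

lemma ssign_s_nbhd_corona:
  "ssign (s_nbhd_corona S1 S2) {Inl u, Inl v} = ssign S1 {u, v}"
  "ssign (s_nbhd_corona S1 S2) {Inr (v, x), Inr (v, y)} = ssign S2 {x, y}"
  "ssign (s_nbhd_corona S1 S2) {Inl u, Inr (v, x)} = ssign S1 {u, v}"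
  by (auto simp: s_nbhd_corona_def)

lemma signed_graph_s_nbhd_corona:
  assumes "signed_graph S1" "signed_graph S2"
  shows "signed_graph (s_nbhd_corona S1 S2)"
proof -
  let ?C = "s_nbhd_corona S1 S2"
  have edge: "u \<noteq> v \<and> u \<in> sverts S \<and> v \<in> sverts S \<and> ssign S {u, v} \<in> {-1, 1}"
    if "signed_graph S" "{u, v} \<in> sedges S" for S :: "'c sgraph" and u v
  proof -
    have "card {u, v} = 2" "{u, v} \<subseteq> sverts S" "ssign S {u, v} \<in> {-1, 1}"
      using that unfolding signed_graph_def by blast+
    then show ?thesis by (cases "u = v") simp_all
  qed
  have verts: "Inl u \<in> sverts ?C \<longleftrightarrow> u \<in> sverts S1"
    "Inr (u, x) \<in> sverts ?C \<longleftrightarrow> u \<in> sverts S1 \<and> x \<in> sverts S2" for u x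
    by (auto simp: s_nbhd_corona_def)
  have "e \<subseteq> sverts ?C \<and> card e = 2 \<and> ssign ?C e \<in> {-1, 1}" if e: "e \<in> sedges ?C" for e
  proof -
    consider u v where "e = {Inl u, Inl v}" "{u, v} \<in> sedges S1"
      | v x y where "e = {Inr (v, x), Inr (v, y)}" "v \<in> sverts S1" "{x, y} \<in> sedges S2"
      | u v x where "e = {Inl u, Inr (v, x)}" "{u, v} \<in> sedges S1" "x \<in> sverts S2"
      using e unfolding s_nbhd_corona_def by auto
    then show ?thesis
    proof cases
      case 1
      show ?thesis using edge[OF assms(1) 1(2)]
        unfolding 1(1) ssign_s_nbhd_corona by (simp add: verts)
    next
      case 2
      show ?thesis using edge[OF assms(2) 2(3)] 2(2)
        unfolding 2(1) ssign_s_nbhd_corona by (simp add: verts)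
    next
      case 3
      show ?thesis using edge[OF assms(1) 3(2)] 3(3)
        unfolding 3(1) ssign_s_nbhd_corona by (simp add: verts)
    qed
  qed
  moreover have "finite (sverts ?C)"
    using assms by (simp add: signed_graph_def s_nbhd_corona_def)
  ultimately show ?thesis
    unfolding signed_graph_def by blast
qed

end

theory Submission
  imports Defs "Jordan_Normal_Form.Schur_Decomposition"
begin

text \<open>
  Let \<open>s = r\<^sub>1 + r\<^sub>2 - r\<^sub>3\<close>. Listing the copy of \<open>S\<^sub>1\<close> first and then the copies of \<open>S\<^sub>2\<close>, the matrix
  \<open>x - L\<close> of the corona has the diagonal blocks \<open>P = x - r\<^sub>1 n\<^sub>2 - L\<^sub>1\<close> and
  \<open>Q = diag (M, \<dots>, M)\<close> with \<open>M = x - r\<^sub>1 - L\<^sub>2\<close>; the off-diagonal block \<open>B\<close> is the adjacency matrix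
  \<open>A\<^sub>1 = r\<^sub>1 - L\<^sub>1\<close> with every column repeated \<open>n\<^sub>2\<close> times. All column sums of \<open>M\<close> equal \<open>c = x - s\<close>,
  so \<open>B Q = c B\<close>, and a block row operation gives, without inverting \<open>Q\<close>,
  \<open>c ^ n\<^sub>1 * det (x - L) = det (c P - n\<^sub>2 A\<^sub>1\<^sup>2) * det M ^ n\<^sub>1\<close>.
  The first factor is the determinant of a quadratic polynomial in \<open>L\<^sub>1\<close>, which triangularisation
  evaluates on the eigenvalues of \<open>L\<^sub>1\<close>; the second factor contains \<open>c ^ n\<^sub>1\<close>, coming from \<open>\<lambda>\<^sub>k(S\<^sub>2)\<close>.
  Cancelling \<open>c ^ n\<^sub>1\<close> at all \<open>x \<noteq> s\<close> determines the characteristic polynomial.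
\<close>

section \<open>Split polynomials and determinants\<close>

text \<open>Induction on the degree: any element of the root multiset gives a linear factor, and
  dividing it out lowers the degree and the number of roots by one each and keeps the quotient
  monic.\<close>

lemma split_poly_eq_prod_proots:
  fixes p :: "'a :: field poly"
  assumes "size (proots p) = degree p" and "lead_coeff p = 1"
  shows "p = (\<Prod>a\<in>#proots p. [:- a, 1:])"
  using assms
proof (induction "degree p" arbitrary: p)
  case 0
  then show ?case by (metis lead_coeff_pCons(2) degree_0_id image_mset_empty one_pCons
        prod_mset_empty size_eq_0_iff_empty)
next
  case (Suc n)
  have p0: "p \<noteq> 0" using Suc.prems by auto
  obtain a where "a \<in># proots p" using Suc by (metis Zero_not_Suc multiset_nonemptyE size_empty)
  then obtain q where p: "p = [:- a, 1:] * q"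
    using p0 by (auto simp: poly_eq_0_iff_dvd)
  have q0: "q \<noteq> 0" using p p0 by auto
  have pr: "proots p = {#a#} + proots q" unfolding p using q0 by (subst proots_mult) auto
  have deg: "degree p = Suc (degree q)" unfolding p using q0 by (subst degree_mult_eq) auto
  have "lead_coeff q = 1" using Suc.prems(2) unfolding p lead_coeff_mult by simp
  then have "q = (\<Prod>a\<in>#proots q. [:- a, 1:])"
    using Suc.hyps(2) Suc.prems(1) pr deg by (intro Suc.hyps(1)) auto
  then show ?case using pr p by simp
qed

text \<open>A root multiset of size \<open>n\<close> exhausts the degree of the monic characteristic
  polynomial, which therefore splits. The product over a list is the form that Schur decomposition
  takes.\<close>

lemma char_poly_eq_prod_list:
  fixes A :: "'a :: field mat"
  assumes A: "A \<in> carrier_mat n n" and "proots (char_poly A) = mset es" and "length es = n"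
  shows "char_poly A = (\<Prod>e\<leftarrow>es. [:- e, 1:])"
  using split_poly_eq_prod_proots[of "char_poly A"] degree_monic_char_poly[OF A] assms(2,3)
  by (simp flip: prod_mset_prod_list)

lemma poly_char_poly:
  fixes A :: "'a :: field mat"
  assumes A: "A \<in> carrier_mat n n"
  shows "poly (char_poly A) x = det (x \<cdot>\<^sub>m 1\<^sub>m n - A)"
proof -
  have "- char_matrix A x = x \<cdot>\<^sub>m 1\<^sub>m n - A"
    using A by (intro eq_matI) (auto simp: char_matrix_def)
  then show ?thesis using char_poly_matrix[OF A] by simp
qed

text \<open>\<open>A\<close> is similar to an upper triangular \<open>T\<close> with diagonal
  \<open>es\<close>. The same similarity carries the quadratic expression in \<open>A\<close> to the
  one in \<open>T\<close>, which is again triangular and has the values of the quadratic at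
  \<open>es\<close> on its diagonal.\<close>

lemma det_quadratic_mat:
  fixes A :: "'a :: conjugatable_ordered_field mat"
  assumes A: "A \<in> carrier_mat n n" and cp: "char_poly A = (\<Prod>e\<leftarrow>es. [:- e, 1:])"
  shows "det (a \<cdot>\<^sub>m 1\<^sub>m n + b \<cdot>\<^sub>m A + d \<cdot>\<^sub>m (A * A)) = (\<Prod>e\<leftarrow>es. a + b * e + d * e\<^sup>2)"
proof -
  obtain T P Q where "schur_decomposition A es = (T, P, Q)" by (metis prod_cases3)
  from schur_decomposition[OF A cp this]
  have wit: "similar_mat_wit A T P Q" and ut: "upper_triangular T" and dg: "diag_mat T = es"
    by auto
  note W = similar_mat_witD2[OF A wit]
  have T: "T \<in> carrier_mat n n" and P: "P \<in> carrier_mat n n" and Q: "Q \<in> carrier_mat n n"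
    using W by auto
  define U where "U = a \<cdot>\<^sub>m 1\<^sub>m n + b \<cdot>\<^sub>m T + d \<cdot>\<^sub>m (T * T)"
  have U: "U \<in> carrier_mat n n" using T unfolding U_def by auto
  have sq: "A * A = P * (T * T) * Q"
  proof -
    \<comment> \<open>Regrouped so that the inner \<open>Q * P\<close> is the identity.\<close>
    have "A * A = P * T * (Q * P) * (T * Q)"
      unfolding W(3) using T P Q by (simp add: assoc_mult_mat[of _ n n _ n _ n])
    also have "\<dots> = P * (T * T) * Q"
      unfolding W(2) using T P Q by (simp add: assoc_mult_mat[of _ n n _ n _ n])
    finally show ?thesis .
  qed
  have "P * U * Q = a \<cdot>\<^sub>m (P * Q) + b \<cdot>\<^sub>m (P * T * Q) + d \<cdot>\<^sub>m (P * (T * T) * Q)"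
    unfolding U_def using T P Q
    by (simp add: mult_add_distrib_mat[of _ n n _ n] add_mult_distrib_mat[of _ n n _ _ n]
        mult_smult_distrib[of _ n n _ n] mult_smult_assoc_mat[of _ n n _ n])
  then have "a \<cdot>\<^sub>m 1\<^sub>m n + b \<cdot>\<^sub>m A + d \<cdot>\<^sub>m (A * A) = P * U * Q"
    unfolding sq W(1) W(3)[symmetric] by simp
  then have "det (a \<cdot>\<^sub>m 1\<^sub>m n + b \<cdot>\<^sub>m A + d \<cdot>\<^sub>m (A * A)) = det U"
    using W(1,2) U P Q A
    by (intro det_similar) (auto simp: similar_mat_def intro!: exI similar_mat_witI[of _ _ n])
  also have "\<dots> = prod_list (diag_mat U)"
  proof (rule det_upper_triangular[OF _ U])
    have "(T * T) $$ (i, j) = 0" if "i < n" "j < i" for i j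
    proof -
      \<comment> \<open>For \<open>k < i\<close> the first factor lies below the diagonal; otherwise
        \<open>j < i \<le> k\<close> and the second one does.\<close>
      have "T $$ (i, k) * T $$ (k, j) = 0" if "k < n" for k
        using ut T \<open>i < n\<close> \<open>j < i\<close> that
        unfolding upper_triangular_def by (cases "k < i") auto
      then show ?thesis using T that by (auto simp: scalar_prod_def intro!: sum.neutral)
    qed
    then show "upper_triangular U"
      using ut T unfolding U_def upper_triangular_def by auto
  qed
  also have "diag_mat U = map (\<lambda>e. a + b * e + d * e\<^sup>2) es"
  proof -
    have "(T * T) $$ (i, i) = (T $$ (i, i))\<^sup>2" if i: "i < n" for i
    proof -
      have "(T * T) $$ (i, i) = (\<Sum>k = 0..<n. T $$ (i, k) * T $$ (k, i))"
        using T i by (auto simp: scalar_prod_def)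
      also have "\<dots> = (\<Sum>k = 0..<n. if k = i then (T $$ (i, i))\<^sup>2 else 0)"
      proof (rule sum.cong)
        fix k assume "k \<in> {0..<n}"
        then show "T $$ (i, k) * T $$ (k, i) = (if k = i then (T $$ (i, i))\<^sup>2 else 0)"
          using ut T i unfolding upper_triangular_def
          by (cases k i rule: linorder_cases) (auto simp: power2_eq_square)
      qed simp
      also have "\<dots> = (T $$ (i, i))\<^sup>2" using i by simp
      finally show ?thesis .
    qed
    then show ?thesis unfolding dg[symmetric]
      using T by (auto simp: diag_mat_def U_def)
  qed
  finally show ?thesis .
qed

text \<open>A Schur complement argument in which the relation \<open>B * Q = c B\<close> takes the
  place of an inverse of \<open>Q\<close>.\<close>

lemma det_four_block_mat_eigen_block:
  fixes P :: "'a :: field mat"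
  assumes P: "P \<in> carrier_mat n n" and B: "B \<in> carrier_mat n m"
    and C: "C \<in> carrier_mat m n" and Q: "Q \<in> carrier_mat m m"
    and BQ: "B * Q = c \<cdot>\<^sub>m B" and c: "c \<noteq> 0"
  shows "c ^ n * det (four_block_mat P B C Q) = det (c \<cdot>\<^sub>m P - B * C) * det Q"
proof -
  \<comment> \<open>Left multiplication by \<open>?E\<close> scales the top block row by
    \<open>c\<close> and subtracts \<open>B\<close> times the bottom one. The top right block
    becomes \<open>c B - B Q = 0\<close>, and \<open>det ?E = c ^ n\<close>.\<close>
  let ?E = "four_block_mat (c \<cdot>\<^sub>m 1\<^sub>m n) (- B) (0\<^sub>m m n) (1\<^sub>m m)"
  let ?F = "four_block_mat P B C Q"
  have E: "?E \<in> carrier_mat (n + m) (n + m)" and F: "?F \<in> carrier_mat (n + m) (n + m)"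
    using P B C Q by auto
  have scale: "(c \<cdot>\<^sub>m 1\<^sub>m n) * X = c \<cdot>\<^sub>m X" if "X \<in> carrier_mat n k" for X k
    using mult_smult_assoc_mat[of "1\<^sub>m n" n n X k c] that by simp
  have "?E * ?F = four_block_mat ((c \<cdot>\<^sub>m 1\<^sub>m n) * P + (- B) * C) ((c \<cdot>\<^sub>m 1\<^sub>m n) * B + (- B) * Q)
      (0\<^sub>m m n * P + 1\<^sub>m m * C) (0\<^sub>m m n * B + 1\<^sub>m m * Q)"
    by (rule mult_four_block_mat) (use P B C Q in auto)
  also have "(c \<cdot>\<^sub>m 1\<^sub>m n) * P + (- B) * C = c \<cdot>\<^sub>m P - B * C"
    unfolding scale[OF P] using P B C
    by (subst uminus_mult_left_mat) (auto intro: add_uminus_minus_mat)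
  also have "(c \<cdot>\<^sub>m 1\<^sub>m n) * B + (- B) * Q = 0\<^sub>m n m"
  proof -
    have "(- B) * Q = - (B * Q)" using B Q by (subst uminus_mult_left_mat) auto
    then show ?thesis unfolding scale[OF B] BQ using B by (intro eq_matI) auto
  qed
  also have "0\<^sub>m m n * P + 1\<^sub>m m * C = C" using P C by simp
  also have "0\<^sub>m m n * B + 1\<^sub>m m * Q = Q" using B Q by simp
  finally have EF: "?E * ?F = four_block_mat (c \<cdot>\<^sub>m P - B * C) (0\<^sub>m n m) C Q" .
  have "c ^ n * det ?F = det ?E * det ?F"
    using B by (subst det_four_block_mat_lower_left_zero[of _ n _ m]) (auto simp: det_smult)
  also have "\<dots> = det (?E * ?F)" using det_mult[OF E F] by simp
  also have "det (?E * ?F) = det (c \<cdot>\<^sub>m P - B * C) * det Q"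
    unfolding EF using P B C Q by (intro det_four_block_mat_upper_right_zero[of _ n _ m]) auto
  finally show ?thesis .
qed

section \<open>Matrices indexed by pairs: repeated blocks, columns and rows\<close>

lemma div_mod_less:
  fixes t :: nat
  assumes "t < n * m"
  shows "t div m < n" "t mod m < m"
proof -
  have "0 < m" using assms by (cases m) auto
  then show "t div m < n" "t mod m < m" using assms by (simp_all add: less_mult_imp_div_less)
qed

text \<open>The Kronecker product of the identity of size \<open>n\<close> with \<open>M\<close>.
  The quotient of an index by \<open>m\<close> is the number of the copy, the remainder the position
  in it; this is also the order of \<open>List.product\<close>.\<close>

definition block_diag_rep :: "nat \<Rightarrow> nat \<Rightarrow> 'a :: zero mat \<Rightarrow> 'a mat" where
  "block_diag_rep n m M = mat (n * m) (n * m)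
     (\<lambda>(i, j). if i div m = j div m then M $$ (i mod m, j mod m) else 0)"

lemma block_diag_rep_carrier [simp]: "block_diag_rep n m M \<in> carrier_mat (n * m) (n * m)"
  by (simp add: block_diag_rep_def)

text \<open>Induction on the number of copies: the last copy splits off as the lower right block of
  a block diagonal matrix.\<close>

lemma det_block_diag_rep:
  fixes M :: "'a :: idom mat"
  assumes M: "M \<in> carrier_mat m m"
  shows "det (block_diag_rep n m M) = det M ^ n"
proof (induction n)
  case 0
  then show ?case by (simp add: det_dim_zero block_diag_rep_def)
next
  case (Suc n)
  let ?F = "four_block_mat (block_diag_rep n m M) (0\<^sub>m (n * m) m) (0\<^sub>m m (n * m)) M"
  have dim: "dim_row (block_diag_rep n m M) = n * m" "dim_col (block_diag_rep n m M) = n * m"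
    by (simp_all add: block_diag_rep_def)
  \<comment> \<open>Indices from \<open>n * m\<close> on belong to the last copy, which has number
    \<open>n\<close> because copies are counted from 0.\<close>
  have last: "i div m = n" "i mod m = i - n * m" "i - n * m < m"
    if "\<not> i < n * m" "i < Suc n * m" for i
  proof -
    define t where "t = i - n * m"
    have "i = n * m + t" "t < m" using that by (auto simp: t_def)
    then show "i div m = n" "i mod m = i - n * m" "i - n * m < m" by auto
  qed
  have "block_diag_rep (Suc n) m M = ?F"
  proof (rule eq_matI)
    fix i j assume "i < dim_row ?F" "j < dim_col ?F"
    then have ij: "i < Suc n * m" "j < Suc n * m"
      using M by (simp_all add: dim)
    have L: "block_diag_rep (Suc n) m M $$ (i, j)
        = (if i div m = j div m then M $$ (i mod m, j mod m) else 0)"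
      using ij by (simp add: block_diag_rep_def del: mult_Suc)
    have R: "?F $$ (i, j) = (if i < n * m
        then if j < n * m then block_diag_rep n m M $$ (i, j) else 0
        else if j < n * m then 0 else M $$ (i - n * m, j - n * m))"
      using ij M by (auto simp: dim)
    consider "i < n * m" "j < n * m" | "i < n * m" "\<not> j < n * m"
      | "\<not> i < n * m" "j < n * m" | "\<not> i < n * m" "\<not> j < n * m" by blast
    then show "block_diag_rep (Suc n) m M $$ (i, j) = ?F $$ (i, j)"
    proof cases
      case 1
      then show ?thesis unfolding L R by (simp add: block_diag_rep_def)
    next
      case 2
      then have "i div m < n" "j div m = n" using div_mod_less[of i n m] last(1)[of j] ij by auto
      then show ?thesis unfolding L R using 2 by simp
    next
      case 3
      then have "j div m < n" "i div m = n" using div_mod_less[of j n m] last(1)[of i] ij by auto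
      then show ?thesis unfolding L R using 3 by simp
    next
      case 4
      then show ?thesis unfolding L R using last[OF 4(1) ij(1)] last[OF 4(2) ij(2)] by simp
    qed
  qed (use M in \<open>auto simp: block_diag_rep_def\<close>)
  then show ?case
    using M Suc.IH by (simp add: det_four_block_mat_upper_right_zero[of _ "n * m" _ m])
qed

text \<open>The Kronecker product of \<open>A\<close> with the all-ones row of length
  \<open>m\<close>; \<open>repeat_rows\<close> uses the all-ones column instead.\<close>

definition repeat_cols :: "nat \<Rightarrow> 'a mat \<Rightarrow> 'a mat" where
  "repeat_cols m A = mat (dim_row A) (dim_col A * m) (\<lambda>(i, j). A $$ (i, j div m))"

definition repeat_rows :: "nat \<Rightarrow> 'a mat \<Rightarrow> 'a mat" where
  "repeat_rows m A = mat (dim_row A * m) (dim_col A) (\<lambda>(i, j). A $$ (i div m, j))"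

text \<open>The map from \<open>(a, b)\<close> to \<open>a * m + b\<close> is a bijection between
  pairs and indices. For \<open>m = 0\<close> both sides are zero.\<close>

lemma sum_div_mod:
  "(\<Sum>t<n * m. f (t div m) (t mod m)) = (\<Sum>a<n. \<Sum>b<m. f a b)" for n m :: nat
proof (cases "m = 0")
  case False
  have "(\<Sum>a<n. \<Sum>b<m. f a b) = (\<Sum>(a, b)\<in>{..<n} \<times> {..<m}. f a b)"
    by (rule sum.cartesian_product)
  also have "\<dots> = (\<Sum>t<n * m. f (t div m) (t mod m))"
  proof (rule sum.reindex_bij_witness[of _ "\<lambda>t. (t div m, t mod m)" "\<lambda>(a, b). a * m + b"])
    fix ab assume ab: "ab \<in> {..<n} \<times> {..<m}"
    obtain a b where [simp]: "ab = (a, b)" and "a < n" "b < m" using ab by auto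
    have "a * m + b < Suc a * m" using \<open>b < m\<close> by simp
    also have "\<dots> \<le> n * m" using \<open>a < n\<close> by (intro mult_le_mono1) simp
    finally show "(case ab of (a, b) \<Rightarrow> a * m + b) \<in> {..<n * m}" by simp
  qed (use False in \<open>auto simp: less_mult_imp_div_less\<close>)
  finally show ?thesis by simp
qed simp

text \<open>Each inner index of \<open>A * B\<close> is met \<open>m\<close> times: the all-ones row
  times the all-ones column is \<open>m\<close>.\<close>

lemma repeat_cols_mult_repeat_rows:
  fixes A B :: "'a :: comm_ring_1 mat"
  assumes A: "A \<in> carrier_mat n n" and B: "B \<in> carrier_mat n n"
  shows "repeat_cols m A * repeat_rows m B = of_nat m \<cdot>\<^sub>m (A * B)"
proof (rule eq_matI)
  fix i j assume "i < dim_row (of_nat m \<cdot>\<^sub>m (A * B))" "j < dim_col (of_nat m \<cdot>\<^sub>m (A * B))"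
  then have ij: "i < n" "j < n" using A B by auto
  have "(repeat_cols m A * repeat_rows m B) $$ (i, j)
      = (\<Sum>t<n * m. A $$ (i, t div m) * B $$ (t div m, j))"
    using A B ij
    by (auto simp: repeat_cols_def repeat_rows_def scalar_prod_def atLeast0LessThan)
  also have "\<dots> = (\<Sum>a<n. \<Sum>b<m. A $$ (i, a) * B $$ (a, j))"
    using sum_div_mod[of "\<lambda>a b. A $$ (i, a) * B $$ (a, j)"] .
  also have "\<dots> = (of_nat m \<cdot>\<^sub>m (A * B)) $$ (i, j)"
    using A B ij by (auto simp: scalar_prod_def atLeast0LessThan sum_distrib_left)
  finally show "(repeat_cols m A * repeat_rows m B) $$ (i, j) = (of_nat m \<cdot>\<^sub>m (A * B)) $$ (i, j)" .
qed (use A B in \<open>auto simp: repeat_cols_def repeat_rows_def\<close>)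

text \<open>Constant column sums say that the all-ones row is a left eigenvector of \<open>M\<close>
  with eigenvalue \<open>c\<close>; each row of \<open>repeat_cols m A\<close> is a multiple of it
  on every block.\<close>

lemma repeat_cols_mult_block_diag_rep:
  fixes A :: "'a :: comm_ring_1 mat"
  assumes A: "A \<in> carrier_mat n n" and M: "M \<in> carrier_mat m m"
    and colsum: "\<And>j. j < m \<Longrightarrow> (\<Sum>i<m. M $$ (i, j)) = c"
  shows "repeat_cols m A * block_diag_rep n m M = c \<cdot>\<^sub>m repeat_cols m A"
proof (rule eq_matI)
  fix i j assume "i < dim_row (c \<cdot>\<^sub>m repeat_cols m A)" "j < dim_col (c \<cdot>\<^sub>m repeat_cols m A)"
  then have i: "i < n" and j: "j < n * m" using A by (auto simp: repeat_cols_def)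
  have jm: "j mod m < m" "j div m < n"
    using div_mod_less[OF j] by auto
  have "(repeat_cols m A * block_diag_rep n m M) $$ (i, j)
      = (\<Sum>t<n * m. A $$ (i, t div m) * (if t div m = j div m then M $$ (t mod m, j mod m) else 0))"
    using A i j
    by (auto simp: repeat_cols_def block_diag_rep_def scalar_prod_def atLeast0LessThan
        intro!: sum.cong)
  also have "\<dots> = (\<Sum>a<n. \<Sum>b<m. A $$ (i, a) * (if a = j div m then M $$ (b, j mod m) else 0))"
    using sum_div_mod[of "\<lambda>a b. A $$ (i, a) * (if a = j div m then M $$ (b, j mod m) else 0)"] .
  also have "\<dots> = (\<Sum>a<n. if a = j div m then A $$ (i, a) * c else 0)"
    using colsum[OF jm(1)] by (intro sum.cong) (auto simp flip: sum_distrib_left)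
  also have "\<dots> = (c \<cdot>\<^sub>m repeat_cols m A) $$ (i, j)"
    using jm i j A by (auto simp: repeat_cols_def)
  finally show "(repeat_cols m A * block_diag_rep n m M) $$ (i, j)
    = (c \<cdot>\<^sub>m repeat_cols m A) $$ (i, j)" .
qed (use A in \<open>auto simp: repeat_cols_def block_diag_rep_def\<close>)

lemma det_corona_block:
  fixes A :: "'a :: field mat"
  assumes P: "P \<in> carrier_mat n n" and A: "A \<in> carrier_mat n n" and M: "M \<in> carrier_mat m m"
    and colsum: "\<And>j. j < m \<Longrightarrow> (\<Sum>i<m. M $$ (i, j)) = c" and c: "c \<noteq> 0"
  shows "c ^ n * det (four_block_mat P (repeat_cols m A) (repeat_rows m A) (block_diag_rep n m M))
    = det (c \<cdot>\<^sub>m P - of_nat m \<cdot>\<^sub>m (A * A)) * det M ^ n"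
proof -
  have "repeat_cols m A \<in> carrier_mat n (n * m)" "repeat_rows m A \<in> carrier_mat (n * m) n"
    using A by (auto simp: repeat_cols_def repeat_rows_def)
  from det_four_block_mat_eigen_block[OF P this block_diag_rep_carrier
      repeat_cols_mult_block_diag_rep[OF A M colsum] c]
  show ?thesis
    unfolding repeat_cols_mult_repeat_rows[OF A A] det_block_diag_rep[OF M] .
qed

text \<open>Brings the first determinant factor into the shape of \<open>det_quadratic_mat\<close>:
  since \<open>A\<close> is a polynomial in \<open>L\<close>, so is the whole expression.\<close>

lemma shifted_square_expansion:
  fixes L :: "real mat"
  assumes L: "L \<in> carrier_mat n n" and A: "A = r \<cdot>\<^sub>m 1\<^sub>m n - L"
  shows "c \<cdot>\<^sub>m (p \<cdot>\<^sub>m 1\<^sub>m n - L) - m \<cdot>\<^sub>m (A * A)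
    = (c * p - m * r\<^sup>2) \<cdot>\<^sub>m 1\<^sub>m n + (2 * m * r - c) \<cdot>\<^sub>m L + (- m) \<cdot>\<^sub>m (L * L)"
proof -
  have "A * A = (r \<cdot>\<^sub>m 1\<^sub>m n - L) * (r \<cdot>\<^sub>m 1\<^sub>m n) - (r \<cdot>\<^sub>m 1\<^sub>m n - L) * L"
    unfolding A using L by (subst mult_minus_distrib_mat[of _ n n _ n]) auto
  also have "(r \<cdot>\<^sub>m 1\<^sub>m n - L) * (r \<cdot>\<^sub>m 1\<^sub>m n) = r \<cdot>\<^sub>m (r \<cdot>\<^sub>m 1\<^sub>m n - L)"
    using L by (subst mult_smult_distrib[of _ n n _ n]) auto
  also have "(r \<cdot>\<^sub>m 1\<^sub>m n - L) * L = r \<cdot>\<^sub>m L - L * L"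
    using L by (subst minus_mult_distrib_mat[of _ n n _ _ n]) (auto simp: mult_smult_assoc_mat[of _ n n _ n])
  finally have sq: "A * A = r \<cdot>\<^sub>m (r \<cdot>\<^sub>m 1\<^sub>m n - L) - (r \<cdot>\<^sub>m L - L * L)" .
  have LL: "L * L \<in> carrier_mat n n" using L by simp
  \<comment> \<open>Entries of \<open>L * L\<close> stay unexpanded, so the entrywise identity is
    linear in the entries of the identity, \<open>L\<close> and \<open>L * L\<close>.\<close>
  show ?thesis
    unfolding sq using L LL
    by (intro eq_matI) (simp_all add: algebra_simps power2_eq_square del: index_mult_mat(1))
qed

section \<open>Signed graphs and the corona\<close>

definition nbhd :: "'a sgraph \<Rightarrow> 'a \<Rightarrow> 'a set" where
  "nbhd S v = {u. {u, v} \<in> sedges S}"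

text \<open>The adjacency entry indexed by vertices instead of list positions, so that sums can
  range over the vertex set.\<close>

definition adj :: "'a sgraph \<Rightarrow> 'a \<Rightarrow> 'a \<Rightarrow> real" where
  "adj S u v = (if {u, v} \<in> sedges S then of_int (ssign S {u, v}) else 0)"

lemma edge_vertices:
  assumes "signed_graph S" "{u, v} \<in> sedges S"
  shows "u \<noteq> v" "u \<in> sverts S" "v \<in> sverts S"
proof -
  have "card {u, v} = 2" "{u, v} \<subseteq> sverts S" using assms unfolding signed_graph_def by blast+
  then show "u \<noteq> v" "u \<in> sverts S" "v \<in> sverts S" by (auto simp: card_insert_if)
qed

lemma finite_sedges:
  assumes "signed_graph S"
  shows "finite (sedges S)"
  by (rule finite_subset[of _ "Pow (sverts S)"]) (use assms in \<open>auto simp: signed_graph_def\<close>)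

text \<open>An edge at \<open>v\<close> has exactly one other end. This turns degrees, which count
  edges, into counts and sums over vertices.\<close>

lemma bij_betw_nbhd:
  assumes S: "signed_graph S"
  shows "bij_betw (\<lambda>u. {u, v}) (nbhd S v) {e \<in> sedges S. v \<in> e}"
proof (rule bij_betw_imageI)
  show "inj_on (\<lambda>u. {u, v}) (nbhd S v)" by (auto simp: inj_on_def doubleton_eq_iff)
  have "\<exists>u. e = {u, v}" if "e \<in> sedges S" "v \<in> e" for e
  proof -
    have "card e = 2" using S that by (auto simp: signed_graph_def)
    then obtain x y where "e = {x, y}" by (auto simp: card_2_iff)
    with that show ?thesis by auto
  qed
  then show "(\<lambda>u. {u, v}) ` nbhd S v = {e \<in> sedges S. v \<in> e}"
    by (auto simp: nbhd_def image_iff)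
qed

lemma vdegree_eq_card_nbhd:
  assumes "signed_graph S"
  shows "vdegree S v = card (nbhd S v)"
  unfolding vdegree_def using bij_betw_same_card[OF bij_betw_nbhd[OF assms]] by simp

text \<open>Signs are 1 or -1, so the difference of the two indicators is the sign itself. Edges at
  \<open>v\<close> are then replaced by neighbours, and \<open>adj\<close> vanishes at all other
  vertices.\<close>

lemma net_degree_eq_sum_adj:
  assumes S: "signed_graph S"
  shows "real_of_int (net_degree S v) = (\<Sum>u\<in>sverts S. adj S u v)"
proof -
  let ?E = "{e \<in> sedges S. v \<in> e}"
  have fin: "finite ?E" using finite_sedges[OF S] by simp
  have "net_degree S v = (\<Sum>e\<in>?E. if ssign S e = 1 then 1 else 0)
      - (\<Sum>e\<in>?E. if ssign S e = -1 then 1 else 0)"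
    unfolding net_degree_def using fin by (simp add: sum.If_cases Int_def conj_ac)
  also have "\<dots> = (\<Sum>e\<in>?E. ssign S e)"
    unfolding sum_subtractf[symmetric]
    using S by (intro sum.cong) (auto simp: signed_graph_def)
  also have "\<dots> = (\<Sum>u\<in>nbhd S v. ssign S {u, v})"
    by (rule sum.reindex_bij_betw[OF bij_betw_nbhd[OF S], symmetric])
  finally have "real_of_int (net_degree S v) = (\<Sum>u\<in>nbhd S v. adj S u v)"
    by (simp add: adj_def nbhd_def)
  also have "\<dots> = (\<Sum>u\<in>sverts S. adj S u v)"
    using S edge_vertices[OF S]
    by (intro sum.mono_neutral_left) (auto simp: signed_graph_def nbhd_def adj_def)
  finally show ?thesis .
qed

section \<open>Vertex listings and entries of the Laplacian matrix\<close>

lemma ex_vertex_listing: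
  assumes "signed_graph S"
  shows "\<exists>vs. vertex_listing S vs"
  using assms finite_distinct_list[of "sverts S"] by (auto simp: signed_graph_def vertex_listing_def)

lemma length_vertex_listing: "vertex_listing S vs \<Longrightarrow> length vs = card (sverts S)"
  by (metis distinct_card vertex_listing_def)

lemma laplacian_mat_carrier [simp]: "laplacian_mat S vs \<in> carrier_mat (length vs) (length vs)"
  unfolding laplacian_mat_def degree_mat_def adjacency_mat_def by (intro minus_carrier_mat) simp

lemma laplacian_mat_index:
  assumes "i < length vs" "j < length vs"
  shows "laplacian_mat S vs $$ (i, j)
    = (if i = j then real (vdegree S (vs ! i)) else 0) - adj S (vs ! i) (vs ! j)"
  using assms by (simp add: laplacian_mat_def degree_mat_def adjacency_mat_def adj_def)

section \<open>Adjacency and degrees in the corona\<close>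

lemma corona_edges:
  "{Inl u, Inl v} \<in> sedges (s_nbhd_corona S1 S2) \<longleftrightarrow> {u, v} \<in> sedges S1"
  "{Inl u, Inr (v, x)} \<in> sedges (s_nbhd_corona S1 S2) \<longleftrightarrow> {u, v} \<in> sedges S1 \<and> x \<in> sverts S2"
  "{Inr (v, x), Inl u} \<in> sedges (s_nbhd_corona S1 S2) \<longleftrightarrow> {u, v} \<in> sedges S1 \<and> x \<in> sverts S2"
  "{Inr (v, x), Inr (w, y)} \<in> sedges (s_nbhd_corona S1 S2)
    \<longleftrightarrow> v = w \<and> v \<in> sverts S1 \<and> {x, y} \<in> sedges S2"
  by (auto simp: s_nbhd_corona_def doubleton_eq_iff insert_commute)

lemma nbhd_corona:
  assumes S1: "signed_graph S1"
  shows "nbhd (s_nbhd_corona S1 S2) (Inl u) = Inl ` nbhd S1 u \<union> Inr ` (nbhd S1 u \<times> sverts S2)"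
    and "v \<in> sverts S1 \<Longrightarrow> x \<in> sverts S2 \<Longrightarrow>
      nbhd (s_nbhd_corona S1 S2) (Inr (v, x)) = Inl ` nbhd S1 v \<union> Inr ` ({v} \<times> nbhd S2 x)"
proof -
  have *: "z \<in> Inl ` X \<longleftrightarrow> (\<exists>a. z = Inl a \<and> a \<in> X)" "z \<in> Inr ` Y \<longleftrightarrow> (\<exists>a. z = Inr a \<and> a \<in> Y)"
    for z :: "'a + 'a \<times> 'b" and X Y by auto
  show "nbhd (s_nbhd_corona S1 S2) (Inl u) = Inl ` nbhd S1 u \<union> Inr ` (nbhd S1 u \<times> sverts S2)"
  proof (rule Set.set_eqI)
    fix z show "z \<in> nbhd (s_nbhd_corona S1 S2) (Inl u)
        \<longleftrightarrow> z \<in> Inl ` nbhd S1 u \<union> Inr ` (nbhd S1 u \<times> sverts S2)"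
      by (cases z) (auto simp: nbhd_def corona_edges * insert_commute)
  qed
  show "nbhd (s_nbhd_corona S1 S2) (Inr (v, x)) = Inl ` nbhd S1 v \<union> Inr ` ({v} \<times> nbhd S2 x)"
    if "v \<in> sverts S1" "x \<in> sverts S2"
  proof (rule Set.set_eqI)
    fix z show "z \<in> nbhd (s_nbhd_corona S1 S2) (Inr (v, x))
        \<longleftrightarrow> z \<in> Inl ` nbhd S1 v \<union> Inr ` ({v} \<times> nbhd S2 x)"
      using that by (cases z) (auto simp: nbhd_def corona_edges * insert_commute)
  qed
qed

lemma finite_nbhd:
  assumes "signed_graph S"
  shows "finite (nbhd S v)"
  by (rule finite_subset[of _ "sverts S"])
    (use assms edge_vertices[OF assms] in \<open>auto simp: signed_graph_def nbhd_def\<close>)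

text \<open>The \<open>Inl\<close> part and the \<open>Inr\<close> part of a neighbourhood are
  disjoint, so their cardinalities add.\<close>

lemma vdegree_corona:
  assumes S1: "signed_graph S1" and S2: "signed_graph S2"
  shows "vdegree (s_nbhd_corona S1 S2) (Inl u) = vdegree S1 u + vdegree S1 u * card (sverts S2)"
    and "v \<in> sverts S1 \<Longrightarrow> x \<in> sverts S2 \<Longrightarrow>
      vdegree (s_nbhd_corona S1 S2) (Inr (v, x)) = vdegree S1 v + vdegree S2 x"
proof -
  note C = signed_graph_s_nbhd_corona[OF S1 S2]
  note fin = finite_nbhd[OF S1] finite_nbhd[OF S2]
  have fin2: "finite (sverts S2)" using S2 by (simp add: signed_graph_def)
  show "vdegree (s_nbhd_corona S1 S2) (Inl u) = vdegree S1 u + vdegree S1 u * card (sverts S2)"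
    unfolding vdegree_eq_card_nbhd[OF C] vdegree_eq_card_nbhd[OF S1] nbhd_corona[OF S1]
    using fin fin2
    by (subst card_Un_disjoint) (auto simp: card_image card_cartesian_product)
  show "vdegree (s_nbhd_corona S1 S2) (Inr (v, x)) = vdegree S1 v + vdegree S2 x"
    if "v \<in> sverts S1" "x \<in> sverts S2"
    unfolding vdegree_eq_card_nbhd[OF C] vdegree_eq_card_nbhd[OF S1] vdegree_eq_card_nbhd[OF S2]
      nbhd_corona(2)[OF S1 that]
    using fin
    by (subst card_Un_disjoint) (auto simp: card_image card_cartesian_product)
qed

lemma adj_corona:
  "adj (s_nbhd_corona S1 S2) (Inl u) (Inl v) = adj S1 u v"
  "x \<in> sverts S2 \<Longrightarrow> adj (s_nbhd_corona S1 S2) (Inl u) (Inr (v, x)) = adj S1 u v"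
  "x \<in> sverts S2 \<Longrightarrow> adj (s_nbhd_corona S1 S2) (Inr (v, x)) (Inl u) = adj S1 v u"
  "v \<in> sverts S1 \<Longrightarrow>
    adj (s_nbhd_corona S1 S2) (Inr (v, x)) (Inr (w, y)) = (if v = w then adj S2 x y else 0)"
  by (auto simp: adj_def corona_edges ssign_s_nbhd_corona insert_commute
      insert_commute[of "Inr _" "Inl _"])

section \<open>Block form of the corona Laplacian\<close>

text \<open>Adjacency enters \<open>x - L\<close> with a plus sign, hence the unsigned off-diagonal
  blocks. On the diagonal, the degree exceeds that in \<open>S1\<close> by \<open>r * m\<close> and
  that in \<open>S2\<close> by \<open>r\<close>; these surpluses are the shifts of
  \<open>x\<close>.\<close>

lemma laplacian_mat_corona:
  assumes S1: "signed_graph S1" and S2: "signed_graph S2"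
    and vs1: "vertex_listing S1 vs1" and vs2: "vertex_listing S2 vs2"
    and reg: "regular_sg r S1"
    and n: "length vs1 = n" and m: "length vs2 = m"
  shows "x \<cdot>\<^sub>m 1\<^sub>m (n + n * m)
      - laplacian_mat (s_nbhd_corona S1 S2) (map Inl vs1 @ map Inr (List.product vs1 vs2))
    = four_block_mat ((x - real r * real m) \<cdot>\<^sub>m 1\<^sub>m n - laplacian_mat S1 vs1)
        (repeat_cols m (adjacency_mat S1 vs1)) (repeat_rows m (adjacency_mat S1 vs1))
        (block_diag_rep n m ((x - real r) \<cdot>\<^sub>m 1\<^sub>m m - laplacian_mat S2 vs2))"
    (is "?L = ?R")
proof (rule eq_matI)
  let ?C = "s_nbhd_corona S1 S2"
  let ?vs = "map Inl vs1 @ map Inr (List.product vs1 vs2)"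
  have lenvs: "length ?vs = n + n * m" by (simp add: n m)
  have set1: "set vs1 = sverts S1" "distinct vs1" and set2: "set vs2 = sverts S2" "distinct vs2"
    using vs1 vs2 by (auto simp: vertex_listing_def)
  have in1: "vs1 ! i \<in> sverts S1" if "i < n" for i using that set1 n nth_mem by metis
  have in2: "vs2 ! i \<in> sverts S2" if "i < m" for i using that set2 m nth_mem by metis
  have deg1: "vdegree S1 (vs1 ! i) = r" if "i < n" for i
    using reg in1[OF that] by (simp add: regular_sg_def)
  have card2: "card (sverts S2) = m" using set2 m distinct_card by metis
  have adjm: "adjacency_mat S1 vs1 $$ (i, j) = adj S1 (vs1 ! i) (vs1 ! j)" if "i < n" "j < n" for i j
    using that by (simp add: adjacency_mat_def adj_def n)
  have dima: "dim_row (adjacency_mat S1 vs1) = n" "dim_col (adjacency_mat S1 vs1) = n"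
    by (auto simp: adjacency_mat_def n)
  have dim: "dim_row (laplacian_mat S1 vs1) = n" "dim_col (laplacian_mat S1 vs1) = n"
    "dim_row (laplacian_mat S2 vs2) = m" "dim_col (laplacian_mat S2 vs2) = m"
    "dim_row (laplacian_mat ?C ?vs) = n + n * m" "dim_col (laplacian_mat ?C ?vs) = n + n * m"
    using laplacian_mat_carrier[of S1 vs1] laplacian_mat_carrier[of S2 vs2]
      laplacian_mat_carrier[of ?C ?vs] by (auto simp: n m)
  show "dim_row ?L = dim_row ?R" "dim_col ?L = dim_col ?R"
    by (auto simp: dim block_diag_rep_def)
  fix i j assume "i < dim_row ?R" "j < dim_col ?R"
  then have i: "i < n + n * m" and j: "j < n + n * m"
    by (auto simp: dim block_diag_rep_def)
  have left: "?vs ! t = Inl (vs1 ! t)" if "t < n" for t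
    using that by (simp add: nth_append n)
  \<comment> \<open>Past the first \<open>n\<close> positions, \<open>t - n\<close> encodes the copy
    and the vertex in it.\<close>
  have right: "?vs ! t = Inr (vs1 ! ((t - n) div m), vs2 ! ((t - n) mod m))"
    "(t - n) div m < n" "(t - n) mod m < m" "t - n < n * m" if "\<not> t < n" "t < n + n * m" for t
  proof -
    show "t - n < n * m" using that by linarith
    then show "(t - n) div m < n" "(t - n) mod m < m"
      using div_mod_less by auto
    show "?vs ! t = Inr (vs1 ! ((t - n) div m), vs2 ! ((t - n) mod m))"
      using that \<open>t - n < n * m\<close> by (simp add: nth_append n m product_nth)
  qed
  have L: "?L $$ (i, j) = (if i = j then x - real (vdegree ?C (?vs ! i)) else 0)
      + adj ?C (?vs ! i) (?vs ! j)"
    using i j laplacian_mat_index[of i ?vs j ?C, unfolded lenvs, OF i j] by (simp add: dim)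
  have R: "?R $$ (i, j) = (if i < n
      then if j < n then ((x - real r * real m) \<cdot>\<^sub>m 1\<^sub>m n - laplacian_mat S1 vs1) $$ (i, j)
        else repeat_cols m (adjacency_mat S1 vs1) $$ (i, j - n)
      else if j < n then repeat_rows m (adjacency_mat S1 vs1) $$ (i - n, j)
        else block_diag_rep n m ((x - real r) \<cdot>\<^sub>m 1\<^sub>m m - laplacian_mat S2 vs2) $$ (i - n, j - n))"
    using i j by (simp add: dim block_diag_rep_def)
  consider "i < n" "j < n" | "i < n" "\<not> j < n" | "\<not> i < n" "j < n" | "\<not> i < n" "\<not> j < n" by auto
  then show "?L $$ (i, j) = ?R $$ (i, j)"
  proof cases
    case 1
    then show ?thesis unfolding L R left[OF 1(1)] left[OF 1(2)]
      using laplacian_mat_index[of i vs1 j S1]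
      by (simp add: adj_corona vdegree_corona[OF S1 S2] deg1 card2 dim n)
  next
    case 2
    note r = right[OF 2(2) j]
    show ?thesis unfolding L R left[OF 2(1)] r(1)
      using 2 r(2-) by (simp add: adj_corona in2 repeat_cols_def dima adjm)
  next
    case 3
    note r = right[OF 3(1) i]
    show ?thesis unfolding L R left[OF 3(2)] r(1)
      using 3 r(2-) by (simp add: adj_corona in2 repeat_rows_def dima adjm)
  next
    case 4
    define a where "a = (i - n) div m"
    define b where "b = (i - n) mod m"
    define a' where "a' = (j - n) div m"
    define b' where "b' = (j - n) mod m"
    note ri = right[OF 4(1) i, folded a_def b_def] and rj = right[OF 4(2) j, folded a'_def b'_def]
    \<comment> \<open>Diagonal positions are recognised by \<open>i = j\<close> on the left side,
      but by block number and position in the block on the right.\<close>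
    have eq: "i = j \<longleftrightarrow> a = a' \<and> b = b'"
      unfolding a_def b_def a'_def b'_def using 4 by (metis div_mult_mod_eq eq_diff_iff not_less)
    \<comment> \<open>The corona compares base vertices, the block matrix compares block numbers;
      distinctness of \<open>vs1\<close> identifies the two.\<close>
    have eq': "vs1 ! a = vs1 ! a' \<longleftrightarrow> a = a'"
      using set1(2) ri(2) rj(2) n by (simp add: nth_eq_iff_index_eq)
    have "?R $$ (i, j) = (if a = a' then ((x - real r) \<cdot>\<^sub>m 1\<^sub>m m - laplacian_mat S2 vs2) $$ (b, b') else 0)"
      unfolding R a_def b_def a'_def b'_def using 4 ri(4) rj(4) by (simp add: block_diag_rep_def)
    also have "\<dots> = (if a = a' then (if b = b' then x - real r - real (vdegree S2 (vs2 ! b)) else 0)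
        + adj S2 (vs2 ! b) (vs2 ! b') else 0)"
      using ri(3) rj(3) laplacian_mat_index[of b vs2 b' S2] by (simp add: dim m)
    also have "\<dots> = ?L $$ (i, j)"
      unfolding L ri(1) rj(1) eq using ri(2,3) rj(2,3)
      by (simp add: adj_corona(4)[OF in1] vdegree_corona(2)[OF S1 S2 in1 in2] deg1 eq')
    finally show ?thesis ..
  qed
qed

section \<open>Column sums, regularity and spectra of the two factors\<close>

text \<open>A column adds up to the degree minus the net-degree of its vertex. For \<open>S2\<close>
  this constant is the eigenvalue \<open>l2 k\<close> of the theorem.\<close>

lemma laplacian_colsum:
  assumes S: "signed_graph S" and vs: "vertex_listing S vs"
    and reg: "regular_sg r S" and net: "net_regular_sg s S" and j: "j < length vs"
  shows "(\<Sum>i<length vs. laplacian_mat S vs $$ (i, j)) = real r - real_of_int s"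
proof -
  have v: "set vs = sverts S" "distinct vs" using vs by (auto simp: vertex_listing_def)
  have vj: "vs ! j \<in> sverts S" using j v nth_mem by blast
  have "(\<Sum>i<length vs. laplacian_mat S vs $$ (i, j))
      = (\<Sum>i<length vs. (if i = j then real r else 0) - adj S (vs ! i) (vs ! j))"
    using j vj reg by (intro sum.cong) (auto simp: laplacian_mat_index regular_sg_def)
  also have "\<dots> = real r - (\<Sum>i<length vs. adj S (vs ! i) (vs ! j))"
    using j by (simp add: sum_subtractf)
  also have "(\<Sum>i<length vs. adj S (vs ! i) (vs ! j)) = (\<Sum>u\<in>sverts S. adj S u (vs ! j))"
    using sum.reindex_bij_betw[OF bij_betw_nth[OF v(2) refl v(1)[symmetric]]] .
  also have "\<dots> = real_of_int s"
    using net vj net_degree_eq_sum_adj[OF S, of "vs ! j"] by (simp add: net_regular_sg_def)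
  finally show ?thesis .
qed

lemma adjacency_mat_regular:
  assumes "vertex_listing S vs" "regular_sg r S"
  shows "adjacency_mat S vs = real r \<cdot>\<^sub>m 1\<^sub>m (length vs) - laplacian_mat S vs"
proof -
  have "vdegree S (vs ! i) = r" if "i < length vs" for i
    using assms that nth_mem by (fastforce simp: vertex_listing_def regular_sg_def)
  then show ?thesis
    by (intro eq_matI) (auto simp: laplacian_mat_def degree_mat_def adjacency_mat_def)
qed

text \<open>Turns a spectrum indexed by \<open>{1..n}\<close> into a list of eigenvalues; the list
  ends at \<open>Suc n\<close> because its upper bound is exclusive.\<close>

lemma char_poly_laplacian:
  assumes "vertex_listing S vs" and "length vs = n"
    and "laplacian_spectrum S = {# l i. i \<in># mset_set {1..n} #}"
  shows "char_poly (laplacian_mat S vs) = (\<Prod>e\<leftarrow>map l [1..<Suc n]. [:- e, 1:])"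
proof (rule char_poly_eq_prod_list)
  have "mset_set {1..n} = mset [1..<Suc n]"
    by (metis atLeastLessThanSuc_atLeastAtMost mset_upt)
  then show "proots (char_poly (laplacian_mat S vs)) = mset (map l [1..<Suc n])"
    using assms laplacian_spectrum_eq[OF assms(1)] by simp
  show "laplacian_mat S vs \<in> carrier_mat n n"
    using laplacian_mat_carrier[of S vs] assms(2) by simp
qed simp

lemma prod_list_upt_Suc:
  "(\<Prod>e\<leftarrow>map l [1..<Suc n]. f e) = (\<Prod>i\<in>{1..n}. f (l i))"
proof -
  have "(\<Prod>i\<in>{1..n}. f (l i)) = (\<Prod>i\<in>set [1..<Suc n]. f (l i))"
    by (simp only: set_upt atLeastLessThanSuc_atLeastAtMost)
  also have "\<dots> = (\<Prod>i\<leftarrow>[1..<Suc n]. f (l i))"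
    by (rule prod.distinct_set_conv_list) simp
  finally show ?thesis by (simp only: map_map o_def)
qed

section \<open>The spectrum of the corona\<close>

theorem theorem3p3:
  fixes S1 :: "'a sgraph" and S2 :: "'b sgraph"
    and n1 n2 r1 r2 k :: nat and r3 :: int
    and l1 l2 :: "nat \<Rightarrow> real"
  assumes "signed_graph S1" and "card (sverts S1) = n1" and "regular_sg r1 S1"
    and "laplacian_spectrum S1 = {# l1 i. i \<in># mset_set {1..n1} #}"
    and "signed_graph S2" and "card (sverts S2) = n2" and "regular_sg r2 S2"
    and "net_regular_sg r3 S2"
    and "laplacian_spectrum S2 = {# l2 j. j \<in># mset_set {1..n2} #}"
    and "1 \<le> k" and "k \<le> n2" and "l2 k = real r2 - real_of_int r3"
  shows "laplacian_spectrum (s_nbhd_corona S1 S2) =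
    (\<Sum>j\<in>{1..n2} - {k}. replicate_mset n1 (l2 j + real r1)) +
    (\<Sum>i\<in>{1..n1}.
       let \<beta> = real r1 + real r2 - real_of_int r3 + l1 i + real r1 * real n2;
           \<Delta> = \<beta>\<^sup>2 + 4 * (real n2 * (l1 i - real r1)\<^sup>2
                 - (l1 i + real r1 * real n2) * (real r1 + real r2 - real_of_int r3))
       in {# (\<beta> + sqrt \<Delta>) / 2, (\<beta> - sqrt \<Delta>) / 2 #})"
proof -
  define s where "s = real r1 + real r2 - real_of_int r3"
  define \<beta> where "\<beta> i = s + l1 i + real r1 * real n2" for i
  define \<Delta> where "\<Delta> i = (\<beta> i)\<^sup>2 + 4 * (real n2 * (l1 i - real r1)\<^sup>2
      - (l1 i + real r1 * real n2) * s)" for i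
  \<comment> \<open>The monic polynomial whose roots are the claimed spectrum; it will be identified
    with the characteristic polynomial.\<close>
  define R where "R = (\<Prod>j\<in>{1..n2} - {k}. [:- (l2 j + real r1), 1:] ^ n1)
      * (\<Prod>i\<in>{1..n1}. [:- ((\<beta> i + sqrt (\<Delta> i)) / 2), 1:] * [:- ((\<beta> i - sqrt (\<Delta> i)) / 2), 1:])"
  obtain vs1 vs2 where vs1: "vertex_listing S1 vs1" and vs2: "vertex_listing S2 vs2"
    using ex_vertex_listing[OF assms(1)] ex_vertex_listing[OF assms(5)] by blast
  have len: "length vs1 = n1" "length vs2 = n2"
    using length_vertex_listing[OF vs1] length_vertex_listing[OF vs2] assms(2,6) by simp_all
  let ?vs = "map Inl vs1 @ map Inr (List.product vs1 vs2)"
  let ?C = "s_nbhd_corona S1 S2"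
  let ?L1 = "laplacian_mat S1 vs1" and ?L2 = "laplacian_mat S2 vs2"
  let ?A = "adjacency_mat S1 vs1"
  have vs: "vertex_listing ?C ?vs"
    using vs1 vs2 by (auto simp: vertex_listing_def s_nbhd_corona_def distinct_map distinct_product)
  have L1: "?L1 \<in> carrier_mat n1 n1" and L2: "?L2 \<in> carrier_mat n2 n2"
    and LC: "laplacian_mat ?C ?vs \<in> carrier_mat (n1 + n1 * n2) (n1 + n1 * n2)"
    using laplacian_mat_carrier[of S1 vs1] laplacian_mat_carrier[of S2 vs2]
      laplacian_mat_carrier[of ?C ?vs] by (simp_all add: len)
  have A: "?A = real r1 \<cdot>\<^sub>m 1\<^sub>m n1 - ?L1"
    using adjacency_mat_regular[OF vs1 assms(3)] len by simp
  have A': "?A \<in> carrier_mat n1 n1" unfolding A using L1 by (rule minus_carrier_mat)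
  \<comment> \<open>With \<open>p = l1 i + r1 n2\<close> and \<open>\<beta> i = p + s\<close>, the
    part \<open>(p + s)^2 - 4 p s\<close> is \<open>(p - s)^2\<close>. Nonnegativity ensures that
    squaring \<open>sqrt (\<Delta> i)\<close> gives back \<open>\<Delta> i\<close>.\<close>
  have \<Delta>_nonneg: "0 \<le> \<Delta> i" for i
  proof -
    have "\<Delta> i = (l1 i + real r1 * real n2 - s)\<^sup>2 + 4 * (real n2 * (l1 i - real r1)\<^sup>2)"
      unfolding \<Delta>_def \<beta>_def by (simp add: power2_eq_square algebra_simps)
    then show ?thesis by simp
  qed
  have pt: "poly (char_poly (laplacian_mat ?C ?vs)) x = poly R x" if "x \<noteq> s" for x
  proof -
    define c where "c = x - s"
    let ?P = "(x - real r1 * real n2) \<cdot>\<^sub>m 1\<^sub>m n1 - ?L1"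
    let ?M = "(x - real r1) \<cdot>\<^sub>m 1\<^sub>m n2 - ?L2"
    have c: "c \<noteq> 0" using that by (simp add: c_def)
    have colsum: "(\<Sum>i<n2. ?M $$ (i, j)) = c" if j: "j < n2" for j
    proof -
      have "(\<Sum>i<n2. ?M $$ (i, j)) = (\<Sum>i<n2. (if i = j then x - real r1 else 0) - ?L2 $$ (i, j))"
        using j L2 by (intro sum.cong) auto
      also have "\<dots> = c"
        using j laplacian_colsum[OF assms(5) vs2 assms(7,8), of j] len
        by (simp add: sum_subtractf c_def s_def)
      finally show ?thesis .
    qed
    \<comment> \<open>\<open>det ?M\<close> is the characteristic polynomial of \<open>?L2\<close>
      at \<open>x - r1\<close>. Its factor for \<open>k\<close> is
      \<open>x - (r2 - r3 + r1) = c\<close>.\<close>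
    have detM: "det ?M = c * (\<Prod>j\<in>{1..n2} - {k}. x - (l2 j + real r1))"
    proof -
      have "det ?M = (\<Prod>j\<in>{1..n2}. x - (l2 j + real r1))"
        using poly_char_poly[OF L2, of "x - real r1"] char_poly_laplacian[OF vs2 len(2) assms(9)]
        by (simp only: prod_list_upt_Suc poly_prod) (simp add: algebra_simps)
      also have "\<dots> = (x - (l2 k + real r1)) * (\<Prod>j\<in>{1..n2} - {k}. x - (l2 j + real r1))"
        using assms(10,11) by (intro prod.remove) auto
      finally show ?thesis using assms(12) by (simp add: c_def s_def algebra_simps)
    qed
    have "poly (char_poly (laplacian_mat ?C ?vs)) x
        = det (four_block_mat ?P (repeat_cols n2 ?A) (repeat_rows n2 ?A) (block_diag_rep n1 n2 ?M))"
      unfolding poly_char_poly[OF LC]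
        laplacian_mat_corona[OF assms(1,5) vs1 vs2 assms(3) len] ..
    then have "c ^ n1 * poly (char_poly (laplacian_mat ?C ?vs)) x
        = det (c \<cdot>\<^sub>m ?P - real n2 \<cdot>\<^sub>m (?A * ?A)) * det ?M ^ n1"
      using det_corona_block[OF minus_carrier_mat[OF L1] A' minus_carrier_mat[OF L2] colsum c] by simp
    also have "det (c \<cdot>\<^sub>m ?P - real n2 \<cdot>\<^sub>m (?A * ?A))
        = (\<Prod>i\<in>{1..n1}. c * (x - real r1 * real n2) - real n2 * (real r1)\<^sup>2
            + (2 * real n2 * real r1 - c) * l1 i + (- real n2) * (l1 i)\<^sup>2)"
      unfolding shifted_square_expansion[OF L1 A]
        det_quadratic_mat[OF L1 char_poly_laplacian[OF vs1 len(1) assms(4)]] prod_list_upt_Suc ..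
    also have "\<dots> = (\<Prod>i\<in>{1..n1}. (x - (\<beta> i + sqrt (\<Delta> i)) / 2) * (x - (\<beta> i - sqrt (\<Delta> i)) / 2))"
    proof (rule prod.cong)
      fix i
      \<comment> \<open>The two roots have sum \<open>\<beta> i\<close> and product
        \<open>((\<beta> i)^2 - \<Delta> i) / 4\<close>, and the definition of
        \<open>\<Delta>\<close> makes the product polynomial in \<open>l1 i\<close>.\<close>
      have "(x - (\<beta> i + sqrt (\<Delta> i)) / 2) * (x - (\<beta> i - sqrt (\<Delta> i)) / 2)
          = x\<^sup>2 - \<beta> i * x + ((\<beta> i)\<^sup>2 - (sqrt (\<Delta> i))\<^sup>2) / 4"
        by (simp add: field_simps power2_eq_square)
      also have "\<dots> = x\<^sup>2 - \<beta> i * x + ((l1 i + real r1 * real n2) * s - real n2 * (l1 i - real r1)\<^sup>2)"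
        using \<Delta>_nonneg[of i] by (simp add: \<Delta>_def)
      also have "\<dots> = c * (x - real r1 * real n2) - real n2 * (real r1)\<^sup>2
          + (2 * real n2 * real r1 - c) * l1 i + (- real n2) * (l1 i)\<^sup>2"
        unfolding \<beta>_def c_def by (simp add: power2_eq_square algebra_simps)
      finally show "c * (x - real r1 * real n2) - real n2 * (real r1)\<^sup>2
          + (2 * real n2 * real r1 - c) * l1 i + (- real n2) * (l1 i)\<^sup>2
          = (x - (\<beta> i + sqrt (\<Delta> i)) / 2) * (x - (\<beta> i - sqrt (\<Delta> i)) / 2)" ..
    qed simp
    also have "\<dots> * det ?M ^ n1 = c ^ n1 * poly R x"
    proof -
      have "poly [:- a, 1:] x = x - a" for a by simp
      then show ?thesis
        unfolding detM R_def
        by (simp only: poly_mult poly_prod poly_power power_mult_distrib prod_power_distrib mult_ac)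
    qed
    finally show ?thesis using c by simp
  qed
  \<comment> \<open>The extra factor makes both sides vanish at the excluded point \<open>s\<close>,
    so they agree everywhere and are equal as polynomials; the nonzero factor then cancels.\<close>
  have "poly (char_poly (laplacian_mat ?C ?vs) * [:- s, 1:]) = poly (R * [:- s, 1:])"
    using pt by (intro ext) (auto simp del: mult_pCons_right)
  then have "char_poly (laplacian_mat ?C ?vs) * [:- s, 1:] = R * [:- s, 1:]"
    unfolding poly_eq_poly_eq_iff .
  then have "char_poly (laplacian_mat ?C ?vs) = R"
    by (subst (asm) mult_right_cancel) auto
  then have "laplacian_spectrum ?C = proots R"
    using laplacian_spectrum_eq[OF vs] by simp
  also have "\<dots> = (\<Sum>j\<in>{1..n2} - {k}. replicate_mset n1 (l2 j + real r1)) +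
      (\<Sum>i\<in>{1..n1}. {# (\<beta> i + sqrt (\<Delta> i)) / 2, (\<beta> i - sqrt (\<Delta> i)) / 2 #})"
  proof -
    have lin: "proots [:- a, 1:] = {#a#}" "[:- a, 1:] \<noteq> 0" for a :: real
      by simp_all
    have rep: "repeat_mset n1 {#a#} = replicate_mset n1 a" for a :: real
      by simp
    have pair: "{#a#} + {#b#} = {#a, b#}" for a b :: real
      by simp
    \<comment> \<open>\<open>proots\<close> is additive on products of nonzero polynomials only,
      since the zero polynomial has the empty multiset as its default value.\<close>
    have nz: "(\<Prod>j\<in>{1..n2} - {k}. [:- (l2 j + real r1), 1:] ^ n1) \<noteq> 0"
      "[:- a, 1:] * [:- b, 1:] \<noteq> 0"
      "(\<Prod>i\<in>{1..n1}. [:- ((\<beta> i + sqrt (\<Delta> i)) / 2), 1:] * [:- ((\<beta> i - sqrt (\<Delta> i)) / 2), 1:]) \<noteq> 0"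
      for a b :: real
      by (auto simp del: mult_pCons_left mult_pCons_right)
    show ?thesis
      unfolding R_def proots_mult[OF nz(1,3)]
      by (simp only: proots_prod nz(2) power_not_zero lin(2) proots_mult proots_power lin rep pair
          not_False_eq_True simp_thms)
  qed
  finally show ?thesis
    by (simp only: Let_def \<beta>_def \<Delta>_def s_def)
qed

end
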